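(* Let $\mathsf Q$ be a dual i-discriminator quasivariety with dual i-discriminator term $p(x,y,z)$. If every fundamental operation commutes with $p(x,y,z)$, then $\mathsf Q$ is primitive.
   Context: A dual i-discriminator function on a set $A$ is a ternary function $p$ such that, writing $\pi(x)=p(x,x,x)$, one has $\pi(\pi(a))=\pi(a)$ for all $a\in A$, and for all $a,b,c\in A$: $p(a,b,c)=\pi(a)$ if $a=b$, and $p(a,b,c)=c$ if $a\neq b$. For a quasivariety $\mathsf Q$ and $\mathbf A\in\mathsf Q$, a $\mathsf Q$-congruence is a congruence $\theta$ with $\mathbf A/\theta\in\mathsf Q$; a nontrivial $\mathbf A\in\mathsf Q$ is $\mathsf Q$-irreducible (subdirectly irreducible relative to $\mathsf Q$) if there are $a\ne b$ in $A$ lying in every nonidentity $\mathsf Q$-congruence. $\mathsf Q$ is a dual i-discriminator quasivariety with term $p(x,y,z)$ if $p$ is a ternary term that interprets as a dual i-discriminator function on every $\mathsf Q$-irreducible algebra of $\mathsf Q$. A fundamental $k$-ary operation $f$ commutes with $p$ if for all $\mathbf A\in\mathsf Q$ and $a,b,c_1,\dots,c_k\in A$, $p(a,b,f(c_1,\dots,c_k))=f(p(a,b,c_1),\dots,p(a,b,c_k))$. A quasivariety $\mathsf Q$ is primitive if every subquasivariety $\mathsf Q'\subseteq\mathsf Q$ satisfies $\mathsf Q'=\mathbf H(\mathsf Q')\cap\mathsf Q$, where $\mathbf H$ denotes homomorphic images. *)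

theory Defs
  imports Main
begin

text \<open>
  A signature maps each of its operation symbols to its arity; the symbols outside its
  domain do not belong to the language (so the empty language is included).

  HOL cannot quantify over algebras on all types at once. A class of algebras is therefore
  a set of algebras whose carriers are nonempty subsets of one universe type \<open>'u\<close>. The
  universe is a free type variable, hence arbitrary: statements about such classes range over
  universes of every cardinality. Membership, relative congruences and relative irreducibility
  of an algebra in the universe are the same whether or not larger algebras are considered. As
  soon as \<open>'u\<close> is infinite and has at least as many elements as the language has symbols,
  inclusions between quasivarieties and primitivity also agree with the notions for proper
  classes: a quasivariety is then determined by its members in the universe, and every \<open>B\<close> in
  the universe that is a homomorphic image of some \<open>A\<close> is already the image of a subalgebra of
  \<open>A\<close> that has a copy in the universe.
\<close>

type_synonym 'f signature = "'f \<Rightarrow> nat option"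

datatype ('f, vars: 'v) trm = Var 'v | App 'f "('f, 'v) trm list"

fun wf_trm :: "'f signature \<Rightarrow> ('f, 'v) trm \<Rightarrow> bool" where
  "wf_trm \<Sigma> (Var x) \<longleftrightarrow> True"
| "wf_trm \<Sigma> (App f ts) \<longleftrightarrow> \<Sigma> f = Some (length ts) \<and> (\<forall>t \<in> set ts. wf_trm \<Sigma> t)"

record ('f, 'u) algebra =
  carrier :: "'u set"
  interp :: "'f \<Rightarrow> 'u list \<Rightarrow> 'u"

text \<open>The values of \<open>interp\<close> outside the signature and the carrier are irrelevant junk.\<close>

definition is_algebra :: "'f signature \<Rightarrow> ('f, 'u) algebra \<Rightarrow> bool" where
  "is_algebra \<Sigma> A \<longleftrightarrow> carrier A \<noteq> {} \<and>
     (\<forall>f cs. \<Sigma> f = Some (length cs) \<and> set cs \<subseteq> carrier A \<longrightarrow> interp A f cs \<in> carrier A)"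

fun eval :: "('f, 'u) algebra \<Rightarrow> ('v \<Rightarrow> 'u) \<Rightarrow> ('f, 'v) trm \<Rightarrow> 'u" where
  "eval A v (Var x) = v x"
| "eval A v (App f ts) = interp A f (map (eval A v) ts)"

definition hom :: "'f signature \<Rightarrow> ('f, 'u) algebra \<Rightarrow> ('f, 'w) algebra \<Rightarrow> ('u \<Rightarrow> 'w) set" where
  "hom \<Sigma> A B = {h. h ` carrier A \<subseteq> carrier B \<and>
     (\<forall>f cs. \<Sigma> f = Some (length cs) \<and> set cs \<subseteq> carrier A \<longrightarrow>
        h (interp A f cs) = interp B f (map h cs))}"

definition isomorphic :: "'f signature \<Rightarrow> ('f, 'u) algebra \<Rightarrow> ('f, 'w) algebra \<Rightarrow> bool" where
  "isomorphic \<Sigma> A B \<longleftrightarrow> (\<exists>h \<in> hom \<Sigma> A B. bij_betw h (carrier A) (carrier B))"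

text \<open>\<open>(ps, (s, t))\<close> stands for the quasi-identity whose premises are the equations in the finite
  (possibly empty) list \<open>ps\<close> and whose conclusion is \<open>s \<approx> t\<close>.\<close>

type_synonym 'f equation = "('f, nat) trm \<times> ('f, nat) trm"
type_synonym 'f quasi_identity = "'f equation list \<times> 'f equation"

definition wf_eq :: "'f signature \<Rightarrow> 'f equation \<Rightarrow> bool" where
  "wf_eq \<Sigma> e \<longleftrightarrow> wf_trm \<Sigma> (fst e) \<and> wf_trm \<Sigma> (snd e)"

definition wf_qid :: "'f signature \<Rightarrow> 'f quasi_identity \<Rightarrow> bool" where
  "wf_qid \<Sigma> q \<longleftrightarrow> (\<forall>e \<in> set (fst q). wf_eq \<Sigma> e) \<and> wf_eq \<Sigma> (snd q)"

definition holds_eq :: "('f, 'u) algebra \<Rightarrow> (nat \<Rightarrow> 'u) \<Rightarrow> 'f equation \<Rightarrow> bool" where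
  "holds_eq A v e \<longleftrightarrow> eval A v (fst e) = eval A v (snd e)"

definition satisfies :: "('f, 'u) algebra \<Rightarrow> 'f quasi_identity \<Rightarrow> bool" where
  "satisfies A q \<longleftrightarrow> (\<forall>v. range v \<subseteq> carrier A \<longrightarrow>
     (\<forall>e \<in> set (fst q). holds_eq A v e) \<longrightarrow> holds_eq A v (snd q))"

definition quasivariety :: "'f signature \<Rightarrow> ('f, 'u) algebra set \<Rightarrow> bool" where
  "quasivariety \<Sigma> Q \<longleftrightarrow> (\<exists>\<Gamma>. (\<forall>q \<in> \<Gamma>. wf_qid \<Sigma> q) \<and>
     Q = {A. is_algebra \<Sigma> A \<and> (\<forall>q \<in> \<Gamma>. satisfies A q)})"

definition congruence :: "'f signature \<Rightarrow> ('f, 'u) algebra \<Rightarrow> ('u \<times> 'u) set \<Rightarrow> bool" where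
  "congruence \<Sigma> A \<theta> \<longleftrightarrow> equiv (carrier A) \<theta> \<and>
     (\<forall>f cs ds. \<Sigma> f = Some (length cs) \<and> list_all2 (\<lambda>c d. (c, d) \<in> \<theta>) cs ds \<longrightarrow>
        (interp A f cs, interp A f ds) \<in> \<theta>)"

text \<open>The operations of the quotient apply the operations of the algebra to chosen
  representatives; for a congruence the choice is immaterial.\<close>

definition quotient_algebra :: "('f, 'u) algebra \<Rightarrow> ('u \<times> 'u) set \<Rightarrow> ('f, 'u set) algebra" where
  "quotient_algebra A \<theta> =
     \<lparr>carrier = carrier A // \<theta>,
      interp = (\<lambda>f Cs. \<theta> `` {interp A f (map (\<lambda>C. SOME c. c \<in> C) Cs)})\<rparr>"

text \<open>The quotient lives on the type \<open>'u set\<close>, so its membership in a class on \<open>'u\<close> is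
  expressed up to isomorphism. No quotient is lost, as it is never larger than the algebra.\<close>

definition rel_congruence ::
    "'f signature \<Rightarrow> ('f, 'u) algebra set \<Rightarrow> ('f, 'u) algebra \<Rightarrow> ('u \<times> 'u) set \<Rightarrow> bool" where
  "rel_congruence \<Sigma> Q A \<theta> \<longleftrightarrow> congruence \<Sigma> A \<theta> \<and>
     (\<exists>B \<in> Q. isomorphic \<Sigma> (quotient_algebra A \<theta>) B)"

definition rel_irreducible ::
    "'f signature \<Rightarrow> ('f, 'u) algebra set \<Rightarrow> ('f, 'u) algebra \<Rightarrow> bool" where
  "rel_irreducible \<Sigma> Q A \<longleftrightarrow> A \<in> Q \<and>
     (\<exists>a \<in> carrier A. \<exists>b \<in> carrier A. a \<noteq> b \<and>
        (\<forall>\<theta>. rel_congruence \<Sigma> Q A \<theta> \<and> \<theta> \<noteq> Id_on (carrier A) \<longrightarrow> (a, b) \<in> \<theta>))"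

definition dual_i_discriminator_on :: "'u set \<Rightarrow> ('u \<Rightarrow> 'u \<Rightarrow> 'u \<Rightarrow> 'u) \<Rightarrow> bool" where
  "dual_i_discriminator_on S p \<longleftrightarrow>
     (\<forall>a \<in> S. \<forall>b \<in> S. \<forall>c \<in> S. p a b c \<in> S) \<and>
     (let \<pi> = (\<lambda>x. p x x x) in
       (\<forall>a \<in> S. \<pi> (\<pi> a) = \<pi> a) \<and>
       (\<forall>a \<in> S. \<forall>b \<in> S. \<forall>c \<in> S. p a b c = (if a = b then \<pi> a else c)))"

text \<open>A ternary term \<open>p(x, y, z)\<close> uses the variables 0, 1, 2 for \<open>x\<close>, \<open>y\<close>, \<open>z\<close>.\<close>

definition ternary_trm :: "'f signature \<Rightarrow> ('f, nat) trm \<Rightarrow> bool" where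
  "ternary_trm \<Sigma> p \<longleftrightarrow> wf_trm \<Sigma> p \<and> vars p \<subseteq> {0, 1, 2}"

definition eval3 :: "('f, 'u) algebra \<Rightarrow> ('f, nat) trm \<Rightarrow> 'u \<Rightarrow> 'u \<Rightarrow> 'u \<Rightarrow> 'u" where
  "eval3 A p a b c = eval A (\<lambda>i. if i = 0 then a else if i = 1 then b else c) p"

definition dual_i_discriminator_quasivariety ::
    "'f signature \<Rightarrow> ('f, 'u) algebra set \<Rightarrow> ('f, nat) trm \<Rightarrow> bool" where
  "dual_i_discriminator_quasivariety \<Sigma> Q p \<longleftrightarrow> quasivariety \<Sigma> Q \<and> ternary_trm \<Sigma> p \<and>
     (\<forall>A. rel_irreducible \<Sigma> Q A \<longrightarrow> dual_i_discriminator_on (carrier A) (eval3 A p))"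

definition commutes_with ::
    "('f, 'u) algebra set \<Rightarrow> 'f \<Rightarrow> nat \<Rightarrow> ('f, nat) trm \<Rightarrow> bool" where
  "commutes_with Q f k p \<longleftrightarrow>
     (\<forall>A \<in> Q. \<forall>a \<in> carrier A. \<forall>b \<in> carrier A. \<forall>cs. length cs = k \<and> set cs \<subseteq> carrier A \<longrightarrow>
        eval3 A p a b (interp A f cs) = interp A f (map (eval3 A p a b) cs))"

definition hom_images :: "'f signature \<Rightarrow> ('f, 'u) algebra set \<Rightarrow> ('f, 'u) algebra set" where
  "hom_images \<Sigma> K = {B. is_algebra \<Sigma> B \<and>
     (\<exists>A \<in> K. \<exists>h \<in> hom \<Sigma> A B. h ` carrier A = carrier B)}"

definition primitive :: "'f signature \<Rightarrow> ('f, 'u) algebra set \<Rightarrow> bool" where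
  "primitive \<Sigma> Q \<longleftrightarrow> quasivariety \<Sigma> Q \<and>
     (\<forall>Q'. quasivariety \<Sigma> Q' \<and> Q' \<subseteq> Q \<longrightarrow> Q' = hom_images \<Sigma> Q' \<inter> Q)"

end

theory Submission
  imports Defs
begin

text \<open>
  Let \<open>Q'\<close> be a subquasivariety of \<open>Q\<close>, let \<open>h\<close> map \<open>A \<in> Q'\<close> onto
  \<open>B \<in> Q\<close>, and suppose that \<open>B\<close> violates a quasi-identity of \<open>Q'\<close>. Any two distinct elements of
  an algebra in \<open>Q\<close> are separated by a homomorphism to a relatively irreducible algebra
  (lemma \<open>separated_by_irreducible\<close>, the subdirect representation theorem), so following \<open>h\<close> by
  such a homomorphism gives \<open>g : A \<rightarrow> C\<close> with \<open>C\<close> irreducible, and an assignment in \<open>A\<close> whose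
  image in \<open>C\<close> satisfies the premises but not the conclusion. It remains to move the assignment
  within \<open>A\<close>, without changing its image in \<open>C\<close>, until the premises hold in \<open>A\<close> itself; the
  conclusion then still fails in \<open>A\<close>, which contradicts \<open>A \<in> Q'\<close>.

  The premises are repaired one at a time. Let \<open>a, b\<close> be the two values of a premise, so
  \<open>g a = g b\<close>, and write \<open>p x y z\<close> for the dual i-discriminator term. Since the operations commute
  with \<open>p\<close>, the map \<open>c \<mapsto> p x (p a b x) c\<close> is an endomorphism of \<open>A\<close> for every \<open>x\<close>. It identifies
  \<open>a\<close> and \<open>b\<close>: this is an identity in \<open>a, b, x\<close>, so it suffices to check it in irreducible
  algebras, where either \<open>a = b\<close>, or \<open>p a b x = x\<close> and the map is constant. Choosing \<open>x\<close> with
  \<open>g x \<noteq> \<pi> (g a)\<close>, where \<open>\<pi> z = p z z z\<close>, makes the map the identity modulo \<open>g\<close>, because in \<open>C\<close> it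
  becomes \<open>p (g x) (\<pi> (g a))\<close> with distinct arguments (lemma \<open>identifying_endomorphism\<close>). Being an
  endomorphism, the map preserves the premises that were repaired earlier.
\<close>

section \<open>Homomorphisms and terms\<close>

lemma hom_carrier: "h \<in> hom \<Sigma> A B \<Longrightarrow> a \<in> carrier A \<Longrightarrow> h a \<in> carrier B"
  by (auto simp: hom_def)

lemma hom_interp:
  "h \<in> hom \<Sigma> A B \<Longrightarrow> \<Sigma> f = Some (length cs) \<Longrightarrow> set cs \<subseteq> carrier A \<Longrightarrow>
     h (interp A f cs) = interp B f (map h cs)"
  by (auto simp: hom_def)

lemma hom_id: "(\<lambda>a. a) \<in> hom \<Sigma> A A"
  by (auto simp: hom_def)

lemma hom_comp:
  assumes g: "g \<in> hom \<Sigma> B C" and h: "h \<in> hom \<Sigma> A B"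
  shows "(\<lambda>a. g (h a)) \<in> hom \<Sigma> A C"
proof -
  have "g (h (interp A f cs)) = interp C f (map (\<lambda>a. g (h a)) cs)"
    if "\<Sigma> f = Some (length cs)" "set cs \<subseteq> carrier A" for f cs
  proof -
    have "set (map h cs) \<subseteq> carrier B"
      using that hom_carrier[OF h] by auto
    then show ?thesis
      using that hom_interp[OF h, of f cs] hom_interp[OF g, of f "map h cs"] by (simp add: comp_def)
  qed
  then show ?thesis
    using hom_carrier[OF g] hom_carrier[OF h] by (auto simp: hom_def)
qed

lemma eval_in_carrier:
  assumes "is_algebra \<Sigma> A" and v: "range v \<subseteq> carrier A" and "wf_trm \<Sigma> t"
  shows "eval A v t \<in> carrier A"
  using \<open>wf_trm \<Sigma> t\<close>
proof (induction t)
  case (Var x)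
  then show ?case using v by auto
next
  case (App f ts)
  then have "set (map (eval A v) ts) \<subseteq> carrier A" and "\<Sigma> f = Some (length (map (eval A v) ts))"
    by auto
  then show ?case
    using assms(1) unfolding is_algebra_def by (metis eval.simps(2))
qed

lemma hom_eval:
  assumes h: "h \<in> hom \<Sigma> A B" and A: "is_algebra \<Sigma> A" and v: "range v \<subseteq> carrier A"
    and "wf_trm \<Sigma> t"
  shows "h (eval A v t) = eval B (\<lambda>i. h (v i)) t"
  using \<open>wf_trm \<Sigma> t\<close>
proof (induction t)
  case (Var x)
  then show ?case by simp
next
  case (App f ts)
  have "set (map (eval A v) ts) \<subseteq> carrier A"
    using App.prems eval_in_carrier[OF A v] by auto
  moreover have "map (\<lambda>t. h (eval A v t)) ts = map (eval B (\<lambda>i. h (v i))) ts"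
    using App by auto
  ultimately show ?case
    using hom_interp[OF h, of f "map (eval A v) ts"] App.prems by (simp add: comp_def del: map_eq_conv)
qed

lemma eval3_in_carrier:
  assumes "is_algebra \<Sigma> A" "wf_trm \<Sigma> p" "a \<in> carrier A" "b \<in> carrier A" "c \<in> carrier A"
  shows "eval3 A p a b c \<in> carrier A"
  unfolding eval3_def by (rule eval_in_carrier[OF assms(1)]) (use assms in auto)

lemma hom_eval3:
  assumes "h \<in> hom \<Sigma> A B" "is_algebra \<Sigma> A" "wf_trm \<Sigma> p"
    and "a \<in> carrier A" "b \<in> carrier A" "c \<in> carrier A"
  shows "h (eval3 A p a b c) = eval3 B p (h a) (h b) (h c)"
proof -
  have "h (eval3 A p a b c) =
      eval B (\<lambda>i. h (if i = 0 then a else if i = (1::nat) then b else c)) p"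
    unfolding eval3_def by (rule hom_eval) (use assms in auto)
  also have "(\<lambda>i. h (if i = 0 then a else if i = (1::nat) then b else c)) =
      (\<lambda>i. if i = 0 then h a else if i = 1 then h b else h c)"
    by auto
  finally show ?thesis
    by (simp add: eval3_def)
qed


section \<open>Kernels and relative congruences\<close>

text \<open>Relative congruences are handled as kernels of homomorphisms onto members of \<open>Q\<close>; this keeps
  every algebra on the universe type and avoids the quotients on its power type.\<close>

definition kernel :: "('f, 'u) algebra \<Rightarrow> ('u \<Rightarrow> 'w) \<Rightarrow> ('u \<times> 'u) set" where
  "kernel A h = {(a, b). a \<in> carrier A \<and> b \<in> carrier A \<and> h a = h b}"

lemma congruence_kernel:
  assumes h: "h \<in> hom \<Sigma> A B" and A: "is_algebra \<Sigma> A"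
  shows "congruence \<Sigma> A (kernel A h)"
proof -
  have "(interp A f cs, interp A f ds) \<in> kernel A h"
    if f: "\<Sigma> f = Some (length cs)" and cd: "list_all2 (\<lambda>c d. (c, d) \<in> kernel A h) cs ds"
    for f cs ds
  proof -
    have len: "length cs = length ds"
      using cd by (rule list_all2_lengthD)
    have "set cs \<subseteq> carrier A" "set ds \<subseteq> carrier A" "map h cs = map h ds"
      using cd by (auto simp: kernel_def list_all2_conv_all_nth in_set_conv_nth intro: nth_equalityI)
    with f len show ?thesis
      using hom_interp[OF h] A unfolding kernel_def is_algebra_def by auto
  qed
  moreover have "equiv (carrier A) (kernel A h)"
    by (auto simp: kernel_def intro!: equivI refl_onI symI transI)
  ultimately show ?thesis
    by (auto simp: congruence_def)
qed

text \<open>Replacing each class by a chosen representative realises the quotient on a subset of the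
  carrier, hence again on the universe type.\<close>

lemma congruence_is_kernel:
  fixes A :: "('f, 'u) algebra"
  assumes "congruence \<Sigma> A \<theta>" and A: "is_algebra \<Sigma> A"
  obtains R :: "('f, 'u) algebra" and r
  where "is_algebra \<Sigma> R" "r \<in> hom \<Sigma> A R" "r ` carrier A = carrier R" "kernel A r = \<theta>"
proof -
  have eq: "equiv (carrier A) \<theta>" and
    cong: "\<And>f cs ds. \<Sigma> f = Some (length cs) \<Longrightarrow> list_all2 (\<lambda>c d. (c, d) \<in> \<theta>) cs ds \<Longrightarrow>
        (interp A f cs, interp A f ds) \<in> \<theta>"
    using assms(1) by (auto simp: congruence_def)
  define r where "r a = (SOME b. b \<in> \<theta> `` {a})" for a
  define R where "R = \<lparr>carrier = r ` carrier A, interp = (\<lambda>f cs. r (interp A f cs))\<rparr>"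
  have r: "(a, r a) \<in> \<theta>" if "a \<in> carrier A" for a
  proof -
    have "a \<in> \<theta> `` {a}"
      using eq that by (rule equiv_class_self)
    then have "r a \<in> \<theta> `` {a}"
      unfolding r_def by (rule someI)
    then show ?thesis by simp
  qed
  have rcong: "r a = r b" if "(a, b) \<in> \<theta>" for a b
    using equiv_class_eq[OF eq that] by (simp add: r_def)
  have sub: "\<theta> \<subseteq> carrier A \<times> carrier A"
    using eq by (rule equiv_type)
  have cl: "interp A f cs \<in> carrier A" if "\<Sigma> f = Some (length cs)" "set cs \<subseteq> carrier A" for f cs
    using A that by (auto simp: is_algebra_def)
  have rA: "r ` carrier A \<subseteq> carrier A"
    using r sub by auto
  have "is_algebra \<Sigma> R"
  proof -
    have "interp A f cs \<in> carrier A" if "\<Sigma> f = Some (length cs)" "set cs \<subseteq> r ` carrier A" for f cs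
      using cl[OF that(1)] that(2) rA by blast
    then show ?thesis
      using A by (auto simp: is_algebra_def R_def)
  qed
  moreover have "r \<in> hom \<Sigma> A R"
  proof -
    have "r (interp A f cs) = r (interp A f (map r cs))"
      if "\<Sigma> f = Some (length cs)" "set cs \<subseteq> carrier A" for f cs
      using that by (intro rcong cong) (auto simp: list_all2_conv_all_nth r subset_iff)
    then show ?thesis
      by (auto simp: hom_def R_def)
  qed
  moreover have "kernel A r = \<theta>"
  proof -
    have "(a, b) \<in> \<theta>" if "a \<in> carrier A" "b \<in> carrier A" "r a = r b" for a b
      using r[OF that(1)] r[OF that(2)] that(3) eq by (metis equiv_class_eq_iff)
    then show ?thesis
      using sub rcong by (auto simp: kernel_def)
  qed
  moreover have "r ` carrier A = carrier R"
    by (simp add: R_def)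
  ultimately show ?thesis
    using that by blast
qed

lemma rel_congruence_is_kernel:
  fixes A :: "('f, 'u) algebra"
  assumes "rel_congruence \<Sigma> Q A \<theta>"
  obtains B k where "B \<in> Q" "k \<in> hom \<Sigma> A B" "k ` carrier A = carrier B" "kernel A k = \<theta>"
proof -
  have eq: "equiv (carrier A) \<theta>" and
    cong: "\<And>f cs ds. \<Sigma> f = Some (length cs) \<Longrightarrow> list_all2 (\<lambda>c d. (c, d) \<in> \<theta>) cs ds \<Longrightarrow>
        (interp A f cs, interp A f ds) \<in> \<theta>"
    using assms by (auto simp: rel_congruence_def congruence_def)
  obtain B j where B: "B \<in> Q" and j: "j \<in> hom \<Sigma> (quotient_algebra A \<theta>) B"
    and bij: "bij_betw j (carrier A // \<theta>) (carrier B)"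
    using assms by (auto simp: rel_congruence_def isomorphic_def quotient_algebra_def)
  define n where "n a = \<theta> `` {a}" for a
  have n_eq: "n a = n b \<longleftrightarrow> (a, b) \<in> \<theta>" if "a \<in> carrier A" "b \<in> carrier A" for a b
    using eq_equiv_class_iff[OF eq that] by (simp add: n_def)
  have n_quot: "n a \<in> carrier A // \<theta>" if "a \<in> carrier A" for a
    using that by (auto simp: n_def quotientI)
  have rep: "(a, SOME c. c \<in> n a) \<in> \<theta>" if "a \<in> carrier A" for a
  proof -
    have "a \<in> n a"
      unfolding n_def using eq that by (rule equiv_class_self)
    then have "(SOME c. c \<in> n a) \<in> n a"
      by (rule someI)
    then show ?thesis by (simp add: n_def)
  qed
  have "n \<in> hom \<Sigma> A (quotient_algebra A \<theta>)"
  proof -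
    have "\<theta> `` {interp A f cs} =
        \<theta> `` {interp A f (map (\<lambda>C. SOME c. c \<in> C) (map n cs))}"
      if "\<Sigma> f = Some (length cs)" "set cs \<subseteq> carrier A" for f cs
    proof -
      have "list_all2 (\<lambda>c d. (c, d) \<in> \<theta>) cs (map (\<lambda>C. SOME c. c \<in> C) (map n cs))"
        using that(2) rep by (auto simp: list_all2_conv_all_nth subset_iff)
      then show ?thesis
        using cong[OF that(1)] by (intro equiv_class_eq[OF eq])
    qed
    then show ?thesis
      using n_quot by (auto simp: hom_def quotient_algebra_def n_def[symmetric])
  qed
  then have "(\<lambda>a. j (n a)) \<in> hom \<Sigma> A B"
    by (rule hom_comp[OF j])
  moreover have "(\<lambda>a. j (n a)) ` carrier A = carrier B"
  proof -
    have "n ` carrier A = carrier A // \<theta>"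
      by (auto simp: n_def quotient_def)
    then show ?thesis
      using bij by (metis bij_betw_imp_surj_on image_image)
  qed
  moreover have "kernel A (\<lambda>a. j (n a)) = \<theta>"
  proof -
    have "j (n a) = j (n b) \<longleftrightarrow> (a, b) \<in> \<theta>" if "a \<in> carrier A" "b \<in> carrier A" for a b
      using bij n_quot that n_eq[OF that] by (metis bij_betw_imp_inj_on inj_on_eq_iff)
    then show ?thesis
      using equiv_type[OF eq] by (auto simp: kernel_def)
  qed
  ultimately show ?thesis
    using that B by blast
qed

text \<open>Validity of a quasi-identity in the quotient by \<open>\<theta>\<close>, expressed inside \<open>A\<close>; read as a closure
  condition on \<open>\<theta>\<close>, it passes to unions of chains because a quasi-identity has only finitely many
  premises.\<close>

definition satisfies_modulo ::
    "('f, 'u) algebra \<Rightarrow> ('u \<times> 'u) set \<Rightarrow> 'f quasi_identity \<Rightarrow> bool" where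
  "satisfies_modulo A \<theta> q \<longleftrightarrow> (\<forall>v. range v \<subseteq> carrier A \<longrightarrow>
     (\<forall>e \<in> set (fst q). (eval A v (fst e), eval A v (snd e)) \<in> \<theta>) \<longrightarrow>
     (eval A v (fst (snd q)), eval A v (snd (snd q))) \<in> \<theta>)"

lemma lift_assignment:
  assumes "h ` carrier A = carrier B" and "range v \<subseteq> carrier B"
  obtains w where "range w \<subseteq> carrier A" "(\<lambda>i. h (w i)) = v"
proof -
  have "\<forall>i. \<exists>a. a \<in> carrier A \<and> h a = v i"
    using assms by (metis imageE rangeI subsetD)
  then obtain w where "\<forall>i. w i \<in> carrier A \<and> h (w i) = v i"
    by metis
  then show ?thesis
    using that[of w] by auto
qed

lemma holds_eq_image_iff_kernel:
  assumes h: "h \<in> hom \<Sigma> A B" and A: "is_algebra \<Sigma> A" and v: "range v \<subseteq> carrier A"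
    and e: "wf_eq \<Sigma> e"
  shows "holds_eq B (\<lambda>i. h (v i)) e \<longleftrightarrow> (eval A v (fst e), eval A v (snd e)) \<in> kernel A h"
  using e eval_in_carrier[OF A v] hom_eval[OF h A v]
  by (auto simp: holds_eq_def wf_eq_def kernel_def)

lemma satisfies_image_iff_modulo_kernel:
  fixes A :: "('f, 'u) algebra" and B :: "('f, 'w) algebra"
  assumes h: "h \<in> hom \<Sigma> A B" and onto: "h ` carrier A = carrier B"
    and A: "is_algebra \<Sigma> A" and q: "wf_qid \<Sigma> q"
  shows "satisfies B q \<longleftrightarrow> satisfies_modulo A (kernel A h) q"
proof -
  have iff: "((\<forall>e \<in> set (fst q). holds_eq B (\<lambda>i. h (v i)) e) \<longrightarrow>
        holds_eq B (\<lambda>i. h (v i)) (snd q)) \<longleftrightarrow>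
      ((\<forall>e \<in> set (fst q). (eval A v (fst e), eval A v (snd e)) \<in> kernel A h) \<longrightarrow>
        (eval A v (fst (snd q)), eval A v (snd (snd q))) \<in> kernel A h)"
    if "range v \<subseteq> carrier A" for v
    using holds_eq_image_iff_kernel[OF h A that] q by (simp add: wf_qid_def)
  have down: "range (\<lambda>i. h (v i)) \<subseteq> carrier B" if "range v \<subseteq> carrier A" for v
    using that hom_carrier[OF h] by auto
  show ?thesis
  proof
    assume B: "satisfies B q"
    show "satisfies_modulo A (kernel A h) q"
      unfolding satisfies_modulo_def
    proof (intro allI, rule impI)
      fix v :: "nat \<Rightarrow> 'u" assume v: "range v \<subseteq> carrier A"
      show "(\<forall>e \<in> set (fst q). (eval A v (fst e), eval A v (snd e)) \<in> kernel A h) \<longrightarrow>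
          (eval A v (fst (snd q)), eval A v (snd (snd q))) \<in> kernel A h"
        unfolding iff[OF v, symmetric] using B down[OF v] unfolding satisfies_def by blast
    qed
  next
    assume A': "satisfies_modulo A (kernel A h) q"
    show "satisfies B q"
      unfolding satisfies_def
    proof (intro allI, rule impI)
      fix v :: "nat \<Rightarrow> 'w" assume "range v \<subseteq> carrier B"
      then obtain w where w: "range w \<subseteq> carrier A" and v: "v = (\<lambda>i. h (w i))"
        using lift_assignment[OF onto] by metis
      show "(\<forall>e \<in> set (fst q). holds_eq B v e) \<longrightarrow> holds_eq B v (snd q)"
        unfolding v iff[OF w] using A' w unfolding satisfies_modulo_def by blast
    qed
  qed
qed


section \<open>Separation by relatively irreducible algebras\<close>

lemma congruence_Union_chain:
  assumes chain: "subset.chain {\<theta>. congruence \<Sigma> A \<theta>} K" and ne: "K \<noteq> {}"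
  shows "congruence \<Sigma> A (\<Union>K)"
proof -
  have K: "congruence \<Sigma> A \<theta>" if "\<theta> \<in> K" for \<theta>
    using chain that by (auto simp: subset.chain_def)
  then have E: "equiv (carrier A) \<theta>" if "\<theta> \<in> K" for \<theta>
    using that by (auto simp: congruence_def)
  have fin: "\<exists>\<theta>\<in>K. S \<subseteq> \<theta>" if "finite S" "S \<subseteq> \<Union>K" for S
    using finite_subset_Union_chain[OF that ne chain] by blast
  have "trans (\<Union>K)"
  proof (rule transI)
    fix x y z assume "(x, y) \<in> \<Union>K" "(y, z) \<in> \<Union>K"
    then obtain \<theta> where "\<theta> \<in> K" "(x, y) \<in> \<theta>" "(y, z) \<in> \<theta>"
      using fin[of "{(x, y), (y, z)}"] by auto
    then show "(x, z) \<in> \<Union>K"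
      using E unfolding equiv_def by (meson UnionI transE)
  qed
  moreover have "sym (\<Union>K)"
    using E unfolding equiv_def by (meson UnionE UnionI symE symI)
  moreover have "\<Union>K \<subseteq> carrier A \<times> carrier A"
    using E equiv_type by blast
  moreover have "refl_on (carrier A) (\<Union>K)"
  proof -
    obtain \<theta> where "\<theta> \<in> K"
      using ne by auto
    then have "refl_on (carrier A) \<theta>"
      using E by (auto elim: equivE)
    with \<open>\<theta> \<in> K\<close> show ?thesis
      by (auto simp: refl_on_def)
  qed
  ultimately have "equiv (carrier A) (\<Union>K)"
    by (auto intro!: equivI)
  moreover have "(interp A f cs, interp A f ds) \<in> \<Union>K"
    if f: "\<Sigma> f = Some (length cs)" and cd: "list_all2 (\<lambda>c d. (c, d) \<in> \<Union>K) cs ds" for f cs ds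
  proof -
    have "set (zip cs ds) \<subseteq> \<Union>K" "length cs = length ds"
      using cd by (auto simp: list_all2_iff)
    then obtain \<theta> where "\<theta> \<in> K" "set (zip cs ds) \<subseteq> \<theta>"
      using fin[of "set (zip cs ds)"] by auto
    then have "list_all2 (\<lambda>c d. (c, d) \<in> \<theta>) cs ds"
      using \<open>length cs = length ds\<close> by (auto simp: list_all2_iff)
    then show ?thesis
      using K[OF \<open>\<theta> \<in> K\<close>] f \<open>\<theta> \<in> K\<close> unfolding congruence_def by blast
  qed
  ultimately show ?thesis
    by (auto simp: congruence_def)
qed

lemma satisfies_modulo_Union_chain:
  assumes chain: "subset.chain {\<theta>. satisfies_modulo A \<theta> q} K" and ne: "K \<noteq> {}"
  shows "satisfies_modulo A (\<Union>K) q"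
  unfolding satisfies_modulo_def
proof (intro allI impI)
  fix v assume v: "range v \<subseteq> carrier A"
    and prem: "\<forall>e \<in> set (fst q). (eval A v (fst e), eval A v (snd e)) \<in> \<Union>K"
  let ?S = "(\<lambda>e. (eval A v (fst e), eval A v (snd e))) ` set (fst q)"
  obtain \<theta> where \<theta>: "\<theta> \<in> K" "?S \<subseteq> \<theta>"
  proof (rule finite_subset_Union_chain[OF _ _ ne chain])
    show "finite ?S" "?S \<subseteq> \<Union>K"
      using prem by auto
  qed
  moreover have "satisfies_modulo A \<theta> q"
    using chain \<theta>(1) by (auto simp: subset.chain_def)
  ultimately show "(eval A v (fst (snd q)), eval A v (snd (snd q))) \<in> \<Union>K"
    using v unfolding satisfies_modulo_def by blast
qed

text \<open>By Zorn's lemma there is a relative congruence \<open>\<theta>\<close> maximal among those that do not relate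
  \<open>x\<close> and \<open>y\<close>. The quotient by \<open>\<theta>\<close> is irreducible: a relative congruence of it that keeps the
  images of \<open>x\<close> and \<open>y\<close> apart pulls back to one above \<open>\<theta>\<close>, hence to \<open>\<theta>\<close> itself.\<close>

lemma separated_by_irreducible:
  fixes A :: "('f, 'u) algebra"
  assumes Q: "quasivariety \<Sigma> Q" and AQ: "A \<in> Q"
    and x: "x \<in> carrier A" and y: "y \<in> carrier A" and "x \<noteq> y"
  obtains C r where "rel_irreducible \<Sigma> Q C" "r \<in> hom \<Sigma> A C" "r x \<noteq> r y"
proof -
  obtain \<Gamma> where wf: "\<And>q. q \<in> \<Gamma> \<Longrightarrow> wf_qid \<Sigma> q"
    and Q_eq: "Q = {A. is_algebra \<Sigma> A \<and> (\<forall>q \<in> \<Gamma>. satisfies A q)}"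
    using Q by (auto simp: quasivariety_def)
  have A: "is_algebra \<Sigma> A"
    using AQ Q_eq by auto
  define Z where
    "Z = {\<theta>. congruence \<Sigma> A \<theta> \<and> (\<forall>q \<in> \<Gamma>. satisfies_modulo A \<theta> q) \<and> (x, y) \<notin> \<theta>}"
  \<comment> \<open>Used for the identity map and for pulled back relative congruences.\<close>
  have Z_kernel: "kernel A k \<in> Z"
    if "k \<in> hom \<Sigma> A B" "k ` carrier A = carrier B" "B \<in> Q" "k x \<noteq> k y"
    for B :: "('f, 'u) algebra" and k
    using that congruence_kernel[OF that(1) A]
      satisfies_image_iff_modulo_kernel[OF that(1,2) A wf] Q_eq
    unfolding Z_def by (auto simp: kernel_def)
  have "kernel A (\<lambda>a. a) \<in> Z"
    using Z_kernel[OF hom_id _ AQ] \<open>x \<noteq> y\<close> by simp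
  then have "Z \<noteq> {}"
    by auto
  moreover have "\<Union>K \<in> Z" if ne: "K \<noteq> {}" and chain: "subset.chain Z K" for K
  proof -
    have KZ: "K \<subseteq> Z"
      using chain by (simp add: subset.chain_def)
    have chain_mono: "subset.chain Y K" if "Z \<subseteq> Y" for Y
      using chain that by (auto simp: subset.chain_def)
    have "congruence \<Sigma> A (\<Union>K)"
      using ne by (intro congruence_Union_chain chain_mono) (auto simp: Z_def)
    moreover have "satisfies_modulo A (\<Union>K) q" if "q \<in> \<Gamma>" for q
      using that ne by (intro satisfies_modulo_Union_chain chain_mono) (auto simp: Z_def)
    moreover have "(x, y) \<notin> \<Union>K"
      using KZ by (auto simp: Z_def)
    ultimately show ?thesis
      by (simp add: Z_def)
  qed
  ultimately obtain \<theta> where \<theta>: "\<theta> \<in> Z" and max: "\<And>\<eta>. \<eta> \<in> Z \<Longrightarrow> \<theta> \<subseteq> \<eta> \<Longrightarrow> \<eta> = \<theta>"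
    using subset_Zorn_nonempty[of Z] by metis
  have "congruence \<Sigma> A \<theta>"
    using \<theta> by (simp add: Z_def)
  then obtain R :: "('f, 'u) algebra" and r where R: "is_algebra \<Sigma> R" and r: "r \<in> hom \<Sigma> A R"
    and onto: "r ` carrier A = carrier R" and ker: "kernel A r = \<theta>"
    using congruence_is_kernel[OF _ A] by blast
  have "R \<in> Q"
    using \<theta> R satisfies_image_iff_modulo_kernel[OF r onto A wf] ker unfolding Q_eq Z_def by auto
  have neq: "r x \<noteq> r y"
    using \<theta> x y unfolding ker[symmetric] Z_def by (auto simp: kernel_def)
  have "(r x, r y) \<in> \<psi>" if \<psi>: "rel_congruence \<Sigma> Q R \<psi>" and nt: "\<psi> \<noteq> Id_on (carrier R)" for \<psi>
  proof (rule ccontr)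
    assume sep: "(r x, r y) \<notin> \<psi>"
    obtain B k where B: "B \<in> Q" and k: "k \<in> hom \<Sigma> R B" and k_onto: "k ` carrier R = carrier B"
      and k_ker: "kernel R k = \<psi>"
      using rel_congruence_is_kernel[OF \<psi>] by blast
    have "k (r x) \<noteq> k (r y)"
      using sep k_ker x y onto by (auto simp: kernel_def)
    moreover have "(\<lambda>a. k (r a)) ` carrier A = carrier B"
      using onto k_onto by (metis image_image)
    ultimately have "kernel A (\<lambda>a. k (r a)) \<in> Z"
      using Z_kernel[OF hom_comp[OF k r]] B by blast
    moreover have "\<theta> \<subseteq> kernel A (\<lambda>a. k (r a))"
      using ker by (auto simp: kernel_def)
    ultimately have "kernel A (\<lambda>a. k (r a)) = kernel A r"
      using max ker by auto
    then have "k (r a) = k (r b) \<longleftrightarrow> r a = r b" if "a \<in> carrier A" "b \<in> carrier A" for a b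
      using that unfolding kernel_def by (auto simp: set_eq_iff)
    then have "kernel R k = Id_on (carrier R)"
      unfolding kernel_def onto[symmetric] by auto
    then show False
      using k_ker nt by simp
  qed
  then have "rel_irreducible \<Sigma> Q R"
    unfolding rel_irreducible_def using \<open>R \<in> Q\<close> hom_carrier[OF r x] hom_carrier[OF r y] neq by blast
  then show ?thesis
    using that r neq by blast
qed


section \<open>Repairing premises by endomorphisms\<close>

lemma quasivariety_is_algebra: "quasivariety \<Sigma> Q \<Longrightarrow> A \<in> Q \<Longrightarrow> is_algebra \<Sigma> A"
  by (auto simp: quasivariety_def)

lemma dual_i_discriminator_irreducible:
  assumes "dual_i_discriminator_quasivariety \<Sigma> Q p" "rel_irreducible \<Sigma> Q C"
    and "a \<in> carrier C" "b \<in> carrier C" "c \<in> carrier C"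
  shows "eval3 C p a b c = (if a = b then eval3 C p a a a else c)"
  using assms unfolding dual_i_discriminator_quasivariety_def dual_i_discriminator_on_def Let_def
  by auto

text \<open>Being an identity, this may be checked under separating homomorphisms \<open>r\<close> to irreducible
  algebras: if \<open>r a = r b\<close> nothing is to be shown, and otherwise \<open>p a b x\<close> becomes \<open>r x\<close>, so that
  both sides become \<open>\<pi> (r x)\<close>.\<close>

lemma discriminator_identifies:
  assumes D: "dual_i_discriminator_quasivariety \<Sigma> Q p" and AQ: "A \<in> Q"
    and x: "x \<in> carrier A" and a: "a \<in> carrier A" and b: "b \<in> carrier A"
  shows "eval3 A p x (eval3 A p a b x) a = eval3 A p x (eval3 A p a b x) b"
proof (rule ccontr)
  assume neq: "\<not> ?thesis"
  have Q: "quasivariety \<Sigma> Q" and p: "wf_trm \<Sigma> p"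
    using D by (auto simp: dual_i_discriminator_quasivariety_def ternary_trm_def)
  have A: "is_algebra \<Sigma> A"
    using Q AQ by (rule quasivariety_is_algebra)
  note cl = eval3_in_carrier[OF A p]
  obtain C r where C: "rel_irreducible \<Sigma> Q C" and r: "r \<in> hom \<Sigma> A C"
    and sep: "r (eval3 A p x (eval3 A p a b x) a) \<noteq> r (eval3 A p x (eval3 A p a b x) b)"
    using separated_by_irreducible[OF Q AQ _ _ neq] cl x a b by metis
  let ?d = "eval3 C p"
  have "?d (r x) (?d (r a) (r b) (r x)) (r a) = ?d (r x) (?d (r a) (r b) (r x)) (r b)"
  proof (cases "r a = r b")
    case False
    then have "?d (r a) (r b) (r x) = r x"
      using dual_i_discriminator_irreducible[OF D C] hom_carrier[OF r] x a b by metis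
    then show ?thesis
      using dual_i_discriminator_irreducible[OF D C] hom_carrier[OF r] x a b by metis
  qed simp
  then show False
    using sep hom_eval3[OF r A p] cl x a b by simp
qed

text \<open>The map \<open>c \<mapsto> p x (p a b x) c\<close> has the required properties as soon as the image of \<open>x\<close> differs
  from \<open>\<pi> (g a)\<close>. Two elements with distinct images ensure that such an \<open>x\<close> exists.\<close>

lemma identifying_endomorphism:
  assumes D: "dual_i_discriminator_quasivariety \<Sigma> Q p"
    and comm: "\<And>f k. \<Sigma> f = Some k \<Longrightarrow> commutes_with Q f k p"
    and AQ: "A \<in> Q" and C: "rel_irreducible \<Sigma> Q C" and g: "g \<in> hom \<Sigma> A C"
    and a: "a \<in> carrier A" and b: "b \<in> carrier A" and gab: "g a = g b"
    and y: "y \<in> carrier A" "z \<in> carrier A" "g y \<noteq> g z"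
  obtains e where "e \<in> hom \<Sigma> A A" "e a = e b" "\<And>c. c \<in> carrier A \<Longrightarrow> g (e c) = g c"
proof -
  have Q: "quasivariety \<Sigma> Q" and p: "wf_trm \<Sigma> p"
    using D by (auto simp: dual_i_discriminator_quasivariety_def ternary_trm_def)
  have A: "is_algebra \<Sigma> A"
    using Q AQ by (rule quasivariety_is_algebra)
  obtain x where x: "x \<in> carrier A" and gx: "g x \<noteq> eval3 C p (g a) (g a) (g a)"
    using y by metis
  \<comment> \<open>The image of \<open>u\<close> is \<open>\<pi> (g a)\<close>, hence differs from \<open>g x\<close>.\<close>
  define u where "u = eval3 A p a b x"
  have u: "u \<in> carrier A"
    unfolding u_def by (rule eval3_in_carrier[OF A p a b x])
  have gu: "g u = eval3 C p (g a) (g a) (g a)"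
    unfolding u_def
    using hom_eval3[OF g A p a b x] gab dual_i_discriminator_irreducible[OF D C] hom_carrier[OF g] a x
    by metis
  have "eval3 A p x u \<in> hom \<Sigma> A A"
    using eval3_in_carrier[OF A p x u] comm x u AQ
    unfolding hom_def commutes_with_def by blast
  moreover have "eval3 A p x u a = eval3 A p x u b"
    unfolding u_def by (rule discriminator_identifies[OF D AQ x a b])
  moreover have "g (eval3 A p x u c) = g c" if "c \<in> carrier A" for c
    using hom_eval3[OF g A p x u that] gx gu dual_i_discriminator_irreducible[OF D C]
      hom_carrier[OF g] x u that by metis
  ultimately show ?thesis
    using that by blast
qed

text \<open>The premises hold in the image \<open>C\<close> only; composing the assignment with one endomorphism per
  premise makes them hold in \<open>A\<close>. The values \<open>y\<close> and \<open>z\<close> with distinct images, for which the two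
  sides of the failing conclusion will serve, make these endomorphisms available.\<close>

lemma repair_premises:
  assumes D: "dual_i_discriminator_quasivariety \<Sigma> Q p"
    and comm: "\<And>f k. \<Sigma> f = Some k \<Longrightarrow> commutes_with Q f k p"
    and AQ: "A \<in> Q" and C: "rel_irreducible \<Sigma> Q C" and g: "g \<in> hom \<Sigma> A C"
    and y: "y \<in> carrier A" "z \<in> carrier A" "g y \<noteq> g z"
    and w: "range w \<subseteq> carrier A"
    and "\<forall>e \<in> set ps. wf_eq \<Sigma> e" and "\<forall>e \<in> set ps. holds_eq C (\<lambda>i. g (w i)) e"
  shows "\<exists>w'. range w' \<subseteq> carrier A \<and> (\<lambda>i. g (w' i)) = (\<lambda>i. g (w i)) \<and>
    (\<forall>e \<in> set ps. holds_eq A w' e)"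
  using assms(10,11)
proof (induction ps)
  case Nil
  then show ?case using w by auto
next
  case (Cons e ps)
  have A: "is_algebra \<Sigma> A"
    using D AQ quasivariety_is_algebra by (auto simp: dual_i_discriminator_quasivariety_def)
  obtain w' where w': "range w' \<subseteq> carrier A" and gw': "(\<lambda>i. g (w' i)) = (\<lambda>i. g (w i))"
    and ps: "\<forall>e \<in> set ps. holds_eq A w' e"
    using Cons by auto
  have e: "wf_trm \<Sigma> (fst e)" "wf_trm \<Sigma> (snd e)"
    using Cons.prems by (auto simp: wf_eq_def)
  let ?a = "eval A w' (fst e)" and ?b = "eval A w' (snd e)"
  have "g ?a = g ?b"
    using hom_eval[OF g A w' e(1)] hom_eval[OF g A w' e(2)] gw' Cons.prems
    by (simp add: holds_eq_def)
  then obtain s where s: "s \<in> hom \<Sigma> A A" and sab: "s ?a = s ?b"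
    and gs: "\<And>c. c \<in> carrier A \<Longrightarrow> g (s c) = g c"
    using identifying_endomorphism[OF D comm AQ C g _ _ _ y] eval_in_carrier[OF A w'] e by metis
  have "holds_eq A (\<lambda>i. s (w' i)) d"
    if "wf_eq \<Sigma> d" "s (eval A w' (fst d)) = s (eval A w' (snd d))" for d
    using that hom_eval[OF s A w'] by (simp add: holds_eq_def wf_eq_def)
  then have "\<forall>d \<in> set (e # ps). holds_eq A (\<lambda>i. s (w' i)) d"
    using sab ps Cons.prems by (auto simp: holds_eq_def)
  moreover have "range (\<lambda>i. s (w' i)) \<subseteq> carrier A"
    using w' hom_carrier[OF s] by auto
  moreover have "(\<lambda>i. g (s (w' i))) = (\<lambda>i. g (w i))"
    using gs w' gw' by (metis rangeI subsetD)
  ultimately show ?case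
    by blast
qed


section \<open>Primitivity\<close>

theorem theorem5p32:
  fixes \<Sigma> :: "'f signature"
    and Q :: "('f, 'u) algebra set"
    and p :: "('f, nat) trm"
  assumes "dual_i_discriminator_quasivariety \<Sigma> Q p"
    and "\<And>f k. \<Sigma> f = Some k \<Longrightarrow> commutes_with Q f k p"
  shows "primitive \<Sigma> Q"
proof -
  note D = assms(1)
  have Q: "quasivariety \<Sigma> Q"
    using D by (simp add: dual_i_discriminator_quasivariety_def)
  have "Q' = hom_images \<Sigma> Q' \<inter> Q" if Q': "quasivariety \<Sigma> Q'" "Q' \<subseteq> Q" for Q'
  proof
    show "Q' \<subseteq> hom_images \<Sigma> Q' \<inter> Q"
    proof
      fix A assume "A \<in> Q'"
      then show "A \<in> hom_images \<Sigma> Q' \<inter> Q"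
        using Q' quasivariety_is_algebra[OF Q'(1)] hom_id[of \<Sigma> A]
        unfolding hom_images_def by (auto intro!: bexI[of _ A] bexI[of _ "\<lambda>a. a"])
    qed
    obtain \<Gamma> where wf: "\<And>q. q \<in> \<Gamma> \<Longrightarrow> wf_qid \<Sigma> q"
      and Q'_eq: "Q' = {A. is_algebra \<Sigma> A \<and> (\<forall>q \<in> \<Gamma>. satisfies A q)}"
      using Q' by (auto simp: quasivariety_def)
    show "hom_images \<Sigma> Q' \<inter> Q \<subseteq> Q'"
    proof
      fix B assume "B \<in> hom_images \<Sigma> Q' \<inter> Q"
      then obtain A h where BQ: "B \<in> Q" and B: "is_algebra \<Sigma> B" and AQ': "A \<in> Q'"
        and h: "h \<in> hom \<Sigma> A B" and onto: "h ` carrier A = carrier B"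
        by (auto simp: hom_images_def)
      have A: "is_algebra \<Sigma> A" and AQ: "A \<in> Q"
        using AQ' Q' quasivariety_is_algebra by auto
      have "satisfies B q" if q: "q \<in> \<Gamma>" for q
        unfolding satisfies_def
      proof (intro allI impI, rule ccontr)
        fix v assume v: "range v \<subseteq> carrier B" and prem: "\<forall>e \<in> set (fst q). holds_eq B v e"
          and concl: "\<not> holds_eq B v (snd q)"
        have wfp: "\<forall>e \<in> set (fst q). wf_eq \<Sigma> e" and wfc: "wf_eq \<Sigma> (snd q)"
          using wf[OF q] by (auto simp: wf_qid_def)
        let ?s = "fst (snd q)" and ?t = "snd (snd q)"
        have st: "wf_trm \<Sigma> ?s" "wf_trm \<Sigma> ?t"
          using wfc by (auto simp: wf_eq_def)
        obtain C r where C: "rel_irreducible \<Sigma> Q C" and r: "r \<in> hom \<Sigma> B C"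
          and sep: "r (eval B v ?s) \<noteq> r (eval B v ?t)"
          using separated_by_irreducible[OF Q BQ, of "eval B v ?s" "eval B v ?t"]
            eval_in_carrier[OF B v] st concl by (auto simp: holds_eq_def)
        obtain w where w: "range w \<subseteq> carrier A" and hw: "(\<lambda>i. h (w i)) = v"
          using lift_assignment[OF onto v] by metis
        define g where "g = (\<lambda>a. r (h a))"
        have g: "g \<in> hom \<Sigma> A C"
          unfolding g_def by (rule hom_comp[OF r h])
        have gw: "(\<lambda>i. g (w i)) = (\<lambda>i. r (v i))"
          using hw by (auto simp: g_def)
        have "holds_eq C (\<lambda>i. r (v i)) e" if "e \<in> set (fst q)" for e
          using prem wfp that hom_eval[OF r B v, symmetric] by (auto simp: holds_eq_def wf_eq_def)
        then have prem_C: "\<forall>e \<in> set (fst q). holds_eq C (\<lambda>i. g (w i)) e"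
          by (simp add: gw)
        have g_eval: "g (eval A u t) = r (eval B v t)"
          if "range u \<subseteq> carrier A" "(\<lambda>i. g (u i)) = (\<lambda>i. g (w i))" "wf_trm \<Sigma> t" for u t
          using hom_eval[OF g A that(1,3)] hom_eval[OF r B v that(3)] that(2) gw by simp
        have "g (eval A w ?s) \<noteq> g (eval A w ?t)"
          using sep g_eval[OF w] st by simp
        then obtain w' where w': "range w' \<subseteq> carrier A" "(\<lambda>i. g (w' i)) = (\<lambda>i. g (w i))"
          and "\<forall>e \<in> set (fst q). holds_eq A w' e"
          using repair_premises[OF D assms(2) AQ C g _ _ _ w wfp prem_C]
            eval_in_carrier[OF A w] st by metis
        then have "holds_eq A w' (snd q)"
          using AQ' q unfolding Q'_eq satisfies_def by blast
        then show False
          using sep g_eval[OF w'] st by (metis holds_eq_def)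
      qed
      then show "B \<in> Q'"
        using B by (simp add: Q'_eq)
    qed
  qed
  then show ?thesis
    using Q by (simp add: primitive_def)
qed

end
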